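(* Let $\mathcal M=(E,\rho)$ be a $q$-matroid and $P(\mathcal M)$ its projectivization matroid. Then for every flat $F$ of $\mathcal M$, the lattice of flats of the $q$-matroid $\mathcal M/F$ is isomorphic to the lattice of flats of the matroid $P(\mathcal M)/P(F)$.
   Context: A $q$-matroid is a pair $(E,\rho)$ where $E$ is a finite-dimensional vector space over the finite field $\mathbb F_q$ and $\rho$ assigns to each subspace a nonnegative integer with $0\le\rho(V)\le\dim V$, monotonicity, and $\rho(V+W)+\rho(V\cap W)\le\rho(V)+\rho(W)$. A flat is a subspace $F$ with $\rho(F+\langle v\rangle)>\rho(F)$ for all $v\notin F$; flats form a lattice under inclusion. $\mathbb PE$ is the set of $1$-dimensional subspaces of $E$; for $V\le E$, $P(V)=\{\langle v\rangle: v\in V-\{0\}\}$; for $S\subseteq\mathbb PE$, $\langle S\rangle$ is the span of the union of the lines in $S$. The projectivization matroid is $P(\mathcal M)=(\mathbb PE,r)$ with $r(S)=\rho(\langle S\rangle)$. Contraction of a $q$-matroid: $\mathcal M/V=(E/V,\rho')$ with $\rho'(W)=\rho(\pi^{-1}(W))-\rho(V)$ for the projection $\pi:E\to E/V$. Matroid contraction: $M/A=(S-A,r')$ with $r'(B)=r(B\cup A)-r(A)$. *)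

theory Defs
  imports "Jordan_Normal_Form.Missing_VectorSpace" "HOL-Algebra.Lattice" "HOL-Algebra.AbelCoset"
begin

section \<open>q-matroids\<close>

text \<open>Rank functions are total in HOL; their values away from the subspaces of \<open>E\<close> (respectively away
  from the subsets of the ground set of a matroid) carry no meaning and are never used.\<close>

locale q_matroid = vectorspace K E
  for K :: "('k, 'm) ring_scheme" and E :: "('k, 'v, 'n) module_scheme" (structure) +
  fixes \<rho> :: "'v set \<Rightarrow> nat"
  assumes finite_field: "finite (carrier K)"
    and finite_dimensional: "fin_dim"
    and rank_le_dim: "subspace K V E \<Longrightarrow> \<rho> V \<le> vectorspace.dim K (vs V)"
    and rank_mono: "\<lbrakk>subspace K V E; subspace K W E; V \<subseteq> W\<rbrakk> \<Longrightarrow> \<rho> V \<le> \<rho> W"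
    and rank_submodular: "\<lbrakk>subspace K V E; subspace K W E\<rbrakk> \<Longrightarrow>
      \<rho> (V <+>\<^bsub>E\<^esub> W) + \<rho> (V \<inter> W) \<le> \<rho> V + \<rho> W"

fun q_flats :: "('k, 'm) ring_scheme \<Rightarrow> ('k, 'v, 'n) module_scheme \<times> ('v set \<Rightarrow> nat) \<Rightarrow> 'v set set"
  where "q_flats K (E, \<rho>) = {F. subspace K F E \<and>
    (\<forall>v \<in> carrier E - F. \<rho> (F <+>\<^bsub>E\<^esub> module.span K E {v}) > \<rho> F)}"

text \<open>The elements of the quotient space are the cosets of \<open>V\<close>. The ring fields \<open>mult\<close> and \<open>one\<close> of
  the record are not part of the vector space structure.\<close>

definition quotient_space :: "('k, 'v, 'n) module_scheme \<Rightarrow> 'v set \<Rightarrow> ('k, 'v set) module"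
  where "quotient_space E V =
    \<lparr>carrier = a_rcosets\<^bsub>E\<^esub> V, mult = undefined, one = undefined, zero = V, add = set_add E,
     smult = (\<lambda>c X. \<Union>x\<in>X. V +>\<^bsub>E\<^esub> (c \<odot>\<^bsub>E\<^esub> x))\<rparr>"

text \<open>The projection sends \<open>v\<close> to the coset \<open>V +>\<^bsub>E\<^esub> v\<close>. By monotonicity of \<open>\<rho>\<close> the subtraction
  does not truncate; the same applies to \<open>matroid_contraction\<close> below.\<close>

fun q_contraction :: "('k, 'v, 'n) module_scheme \<times> ('v set \<Rightarrow> nat) \<Rightarrow> 'v set \<Rightarrow>
    ('k, 'v set) module \<times> ('v set set \<Rightarrow> nat)"
  where "q_contraction (E, \<rho>) V =
    (quotient_space E V, \<lambda>W. \<rho> {v \<in> carrier E. V +>\<^bsub>E\<^esub> v \<in> W} - \<rho> V)"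

section \<open>Matroids, given by ground set and rank function\<close>

fun matroid_flats :: "'s set \<times> ('s set \<Rightarrow> nat) \<Rightarrow> 's set set"
  where "matroid_flats (S, r) = {A. A \<subseteq> S \<and> (\<forall>x \<in> S - A. r (insert x A) > r A)}"

fun matroid_contraction :: "'s set \<times> ('s set \<Rightarrow> nat) \<Rightarrow> 's set \<Rightarrow> 's set \<times> ('s set \<Rightarrow> nat)"
  where "matroid_contraction (S, r) A = (S - A, \<lambda>B. r (B \<union> A) - r A)"

section \<open>Projectivization\<close>

definition projective_space :: "('k, 'm) ring_scheme \<Rightarrow> ('k, 'v, 'n) module_scheme \<Rightarrow> 'v set set"
  where "projective_space K E = {L. subspace K L E \<and> vectorspace.dim K (E\<lparr>carrier := L\<rparr>) = 1}"

definition projective_points ::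
    "('k, 'm) ring_scheme \<Rightarrow> ('k, 'v, 'n) module_scheme \<Rightarrow> 'v set \<Rightarrow> 'v set set"
  where "projective_points K E V = {module.span K E {v} | v. v \<in> V - {\<zero>\<^bsub>E\<^esub>}}"

fun projectivization :: "('k, 'm) ring_scheme \<Rightarrow>
    ('k, 'v, 'n) module_scheme \<times> ('v set \<Rightarrow> nat) \<Rightarrow> 'v set set \<times> ('v set set \<Rightarrow> nat)"
  where "projectivization K (E, \<rho>) = (projective_space K E, \<lambda>S. \<rho> (module.span K E (\<Union>S)))"

section \<open>Lattices\<close>

definition inclusion_order :: "'s set set \<Rightarrow> 's set gorder"
  where "inclusion_order \<F> = \<lparr>carrier = \<F>, eq = (=), le = (\<subseteq>)\<rparr>"

definition lattice_isomorphic :: "('a, 'm) gorder_scheme \<Rightarrow> ('b, 'n) gorder_scheme \<Rightarrow> bool"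
  where "lattice_isomorphic L L' \<longleftrightarrow> lattice L \<and> lattice L' \<and>
    (\<exists>f. bij_betw f (carrier L) (carrier L') \<and>
      (\<forall>x \<in> carrier L. \<forall>y \<in> carrier L.
        f (x \<squnion>\<^bsub>L\<^esub> y) = f x \<squnion>\<^bsub>L'\<^esub> f y \<and> f (x \<sqinter>\<^bsub>L\<^esub> y) = f x \<sqinter>\<^bsub>L'\<^esub> f y))"

end

(* The flats of M/F correspond under preimage along E -> E/F, and the flats of P(M)/P(F)
   correspond under A |-> span (A \<union> P(F)), to the flats of M that contain F. Both
   correspondences preserve and reflect inclusion, and the flats of M above F form a lattice
   because submodularity makes flats closed under intersection. *)

theory Submission
  imports Defs
begin

section \<open>Families of sets ordered by inclusion\<close>

text \<open>Joins of flats are closures of sums, not sums, so the correspondences are never compared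
  on joins directly: they are treated as order isomorphisms, and joins and meets, being determined
  by the order, are carried along. In both contractions the rank of \<open>F\<close> is subtracted
  on each side of the strict inequality that defines a flat. It cancels, and only the effect of one
  added line remains to be compared. The two sides differ in one respect: the flats of the quotient
  are subspaces by definition, whereas a flat of the matroid is merely a set of points, and it is
  flatness that forces it to contain every point of its span outside P(F).\<close>

lemma inclusion_order_simps [simp]:
  "carrier (inclusion_order A) = A"
  "le (inclusion_order A) = (\<subseteq>)"
  "eq (inclusion_order A) = (=)"
  by (simp_all add: inclusion_order_def)

lemma partial_order_inclusion: "partial_order (inclusion_order A)"
  by unfold_locales auto

lemma least_inclusion_iff:
  assumes "x \<in> A" "y \<in> A"
  shows "least (inclusion_order A) s (Upper (inclusion_order A) {x, y}) \<longleftrightarrow>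
    s \<in> A \<and> x \<subseteq> s \<and> y \<subseteq> s \<and> (\<forall>z\<in>A. x \<subseteq> z \<longrightarrow> y \<subseteq> z \<longrightarrow> s \<subseteq> z)"
proof -
  have "Upper (inclusion_order A) {x, y} = {z \<in> A. x \<subseteq> z \<and> y \<subseteq> z}"
    using assms by (auto simp: Upper_def)
  then show ?thesis by (auto simp: least_def)
qed

lemma greatest_inclusion_iff:
  assumes "x \<in> A" "y \<in> A"
  shows "greatest (inclusion_order A) s (Lower (inclusion_order A) {x, y}) \<longleftrightarrow>
    s \<in> A \<and> s \<subseteq> x \<and> s \<subseteq> y \<and> (\<forall>z\<in>A. z \<subseteq> x \<longrightarrow> z \<subseteq> y \<longrightarrow> z \<subseteq> s)"
proof -
  have "Lower (inclusion_order A) {x, y} = {z \<in> A. z \<subseteq> x \<and> z \<subseteq> y}"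
    using assms by (auto simp: Lower_def)
  then show ?thesis by (auto simp: greatest_def)
qed

lemma lattice_inclusionI:
  assumes "\<And>x y. \<lbrakk>x \<in> A; y \<in> A\<rbrakk> \<Longrightarrow> \<exists>s\<in>A. x \<subseteq> s \<and> y \<subseteq> s \<and> (\<forall>z\<in>A. x \<subseteq> z \<longrightarrow> y \<subseteq> z \<longrightarrow> s \<subseteq> z)"
    and "\<And>x y. \<lbrakk>x \<in> A; y \<in> A\<rbrakk> \<Longrightarrow> \<exists>s\<in>A. s \<subseteq> x \<and> s \<subseteq> y \<and> (\<forall>z\<in>A. z \<subseteq> x \<longrightarrow> z \<subseteq> y \<longrightarrow> z \<subseteq> s)"
  shows "lattice (inclusion_order A)"
proof -
  interpret partial_order "inclusion_order A" by (rule partial_order_inclusion)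
  show ?thesis
  proof unfold_locales
    fix x y assume "x \<in> carrier (inclusion_order A)" "y \<in> carrier (inclusion_order A)"
    then have xy: "x \<in> A" "y \<in> A" by simp_all
    from assms(1)[OF xy] show "\<exists>s. least (inclusion_order A) s (Upper (inclusion_order A) {x, y})"
      unfolding least_inclusion_iff[OF xy] by auto
    from assms(2)[OF xy] show "\<exists>s. greatest (inclusion_order A) s (Lower (inclusion_order A) {x, y})"
      unfolding greatest_inclusion_iff[OF xy] by auto
  qed
qed

text \<open>Joins come from meets: the join of two members is the intersection of all members above
  both, a family that is nonempty because it contains the top element \<open>C\<close>.\<close>

lemma lattice_inclusion_Inter:
  assumes top: "C \<in> A" "\<And>x. x \<in> A \<Longrightarrow> x \<subseteq> C"
    and Inter: "\<And>\<G>. \<lbrakk>\<G> \<subseteq> A; \<G> \<noteq> {}\<rbrakk> \<Longrightarrow> \<Inter>\<G> \<in> A"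
  shows "lattice (inclusion_order A)"
proof (rule lattice_inclusionI)
  fix x y assume xy: "x \<in> A" "y \<in> A"
  let ?U = "{z \<in> A. x \<subseteq> z \<and> y \<subseteq> z}"
  have "\<Inter>?U \<in> A" using top xy by (intro Inter) auto
  then show "\<exists>s\<in>A. x \<subseteq> s \<and> y \<subseteq> s \<and> (\<forall>z\<in>A. x \<subseteq> z \<longrightarrow> y \<subseteq> z \<longrightarrow> s \<subseteq> z)"
    by (intro bexI[of _ "\<Inter>?U"]) auto
  have "\<Inter>{x, y} \<in> A" using xy by (intro Inter) auto
  then show "\<exists>s\<in>A. s \<subseteq> x \<and> s \<subseteq> y \<and> (\<forall>z\<in>A. z \<subseteq> x \<longrightarrow> z \<subseteq> y \<longrightarrow> z \<subseteq> s)"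
    by (intro bexI[of _ "\<Inter>{x, y}"]) auto
qed

text \<open>Mentions only the order, so that inverses and composites are immediate; joins and meets
  enter once, in \<open>lattice_isomorphicI\<close>.\<close>

definition inclusion_iso :: "('a set \<Rightarrow> 'b set) \<Rightarrow> 'a set set \<Rightarrow> 'b set set \<Rightarrow> bool"
  where "inclusion_iso f A B \<longleftrightarrow> bij_betw f A B \<and> (\<forall>x\<in>A. \<forall>y\<in>A. f x \<subseteq> f y \<longleftrightarrow> x \<subseteq> y)"

text \<open>Injectivity comes for free: equal images are included in each other, and antisymmetry
  applies.\<close>

lemma inclusion_isoI:
  assumes "f ` A = B" and le: "\<And>x y. \<lbrakk>x \<in> A; y \<in> A\<rbrakk> \<Longrightarrow> f x \<subseteq> f y \<longleftrightarrow> x \<subseteq> y"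
  shows "inclusion_iso f A B"
proof -
  have "x = y" if "x \<in> A" "y \<in> A" "f x = f y" for x y
    using le[OF that(1,2)] le[OF that(2,1)] that(3) by simp
  then have "inj_on f A" by (rule inj_onI)
  then show ?thesis using assms unfolding inclusion_iso_def bij_betw_def by simp
qed

lemma inclusion_iso_inv:
  assumes "inclusion_iso f A B"
  shows "inclusion_iso (inv_into A f) B A"
proof -
  let ?g = "inv_into A f"
  have bij: "bij_betw f A B" and le: "\<And>x y. \<lbrakk>x \<in> A; y \<in> A\<rbrakk> \<Longrightarrow> f x \<subseteq> f y \<longleftrightarrow> x \<subseteq> y"
    using assms by (simp_all add: inclusion_iso_def)
  have inv: "bij_betw ?g B A" using bij by (rule bij_betw_inv_into)
  have "?g x \<subseteq> ?g y \<longleftrightarrow> x \<subseteq> y" if "x \<in> B" "y \<in> B" for x y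
    using le[OF bij_betw_apply[OF inv that(1)] bij_betw_apply[OF inv that(2)]]
    unfolding bij_betw_inv_into_right[OF bij that(1)] bij_betw_inv_into_right[OF bij that(2)] ..
  then show ?thesis using inv by (simp add: inclusion_iso_def)
qed

lemma inclusion_iso_trans:
  assumes "inclusion_iso f A B" "inclusion_iso g B C"
  shows "inclusion_iso (g \<circ> f) A C"
proof -
  have f: "bij_betw f A B" and g: "bij_betw g B C"
    using assms by (simp_all add: inclusion_iso_def)
  have "(g \<circ> f) x \<subseteq> (g \<circ> f) y \<longleftrightarrow> x \<subseteq> y" if "x \<in> A" "y \<in> A" for x y
    using assms bij_betw_apply[OF f that(1)] bij_betw_apply[OF f that(2)] that
    by (simp add: inclusion_iso_def)
  then show ?thesis using bij_betw_trans[OF f g] unfolding inclusion_iso_def by blast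
qed

text \<open>Joins and meets are characterized by universal properties stated in terms of inclusion,
  which an order isomorphism preserves. Hence \<open>B\<close> inherits the lattice property from
  \<open>A\<close>.\<close>

lemma lattice_isomorphicI:
  assumes iso: "inclusion_iso f A B" and A: "lattice (inclusion_order A)"
  shows "lattice_isomorphic (inclusion_order A) (inclusion_order B)"
proof -
  interpret A: lattice "inclusion_order A" by (rule A)
  have bij: "bij_betw f A B" and le: "\<And>x y. \<lbrakk>x \<in> A; y \<in> A\<rbrakk> \<Longrightarrow> f x \<subseteq> f y \<longleftrightarrow> x \<subseteq> y"
    using iso by (auto simp: inclusion_iso_def)
  have img: "f ` A = B" using bij by (simp add: bij_betw_def)
  let ?J = "join (inclusion_order A)" and ?M = "meet (inclusion_order A)"
  have J: "?J x y \<in> A \<and> x \<subseteq> ?J x y \<and> y \<subseteq> ?J x y \<and> (\<forall>z\<in>A. x \<subseteq> z \<longrightarrow> y \<subseteq> z \<longrightarrow> ?J x y \<subseteq> z)"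
    and M: "?M x y \<in> A \<and> ?M x y \<subseteq> x \<and> ?M x y \<subseteq> y \<and> (\<forall>z\<in>A. z \<subseteq> x \<longrightarrow> z \<subseteq> y \<longrightarrow> z \<subseteq> ?M x y)"
    if "x \<in> A" "y \<in> A" for x y
    using that A.join_closed[of x y] A.join_left[of x y] A.join_right[of x y] A.join_le[of x _ y]
      A.meet_closed[of x y] A.meet_left[of x y] A.meet_right[of x y] A.meet_le[of _ x y]
    by (simp_all add: Ball_def)
  \<comment> \<open>Every member of \<open>B\<close> is an image under \<open>f\<close>, so each
    bound over \<open>B\<close> reduces by \<open>le\<close> to one over \<open>A\<close>.\<close>
  have fJ: "f (?J x y) \<in> B \<and> f x \<subseteq> f (?J x y) \<and> f y \<subseteq> f (?J x y) \<and>
      (\<forall>z\<in>B. f x \<subseteq> z \<longrightarrow> f y \<subseteq> z \<longrightarrow> f (?J x y) \<subseteq> z)"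
    and fM: "f (?M x y) \<in> B \<and> f (?M x y) \<subseteq> f x \<and> f (?M x y) \<subseteq> f y \<and>
      (\<forall>z\<in>B. z \<subseteq> f x \<longrightarrow> z \<subseteq> f y \<longrightarrow> z \<subseteq> f (?M x y))"
    if "x \<in> A" "y \<in> A" for x y
    using that J[OF that] M[OF that] le unfolding img[symmetric] by auto
  have B: "lattice (inclusion_order B)"
  proof (rule lattice_inclusionI)
    fix x y assume "x \<in> B" "y \<in> B"
    then obtain x' y' where "x' \<in> A" "y' \<in> A" and [simp]: "x = f x'" "y = f y'"
      using img by blast
    from fJ[OF this(1,2)] fM[OF this(1,2)]
    show "\<exists>s\<in>B. x \<subseteq> s \<and> y \<subseteq> s \<and> (\<forall>z\<in>B. x \<subseteq> z \<longrightarrow> y \<subseteq> z \<longrightarrow> s \<subseteq> z)"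
      "\<exists>s\<in>B. s \<subseteq> x \<and> s \<subseteq> y \<and> (\<forall>z\<in>B. z \<subseteq> x \<longrightarrow> z \<subseteq> y \<longrightarrow> z \<subseteq> s)"
      by auto
  qed
  interpret B: lattice "inclusion_order B" by (rule B)
  have "f (?J x y) = join (inclusion_order B) (f x) (f y)"
    and "f (?M x y) = meet (inclusion_order B) (f x) (f y)"
    if xy: "x \<in> A" "y \<in> A" for x y
  proof -
    have fxy: "f x \<in> B" "f y \<in> B" using xy img by auto
    \<comment> \<open>Both sides are least upper bounds of \<open>f x\<close> and
      \<open>f y\<close>; antisymmetry identifies them.\<close>
    show "f (?J x y) = join (inclusion_order B) (f x) (f y)"
    proof (rule subset_antisym)
      show "f (?J x y) \<subseteq> join (inclusion_order B) (f x) (f y)"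
        using fJ[OF xy] fxy B.join_closed[of "f x" "f y"] B.join_left[of "f x" "f y"]
          B.join_right[of "f x" "f y"] by simp
      show "join (inclusion_order B) (f x) (f y) \<subseteq> f (?J x y)"
        using fJ[OF xy] fxy B.join_le[of "f x" "f (?J x y)" "f y"] by simp
    qed
    show "f (?M x y) = meet (inclusion_order B) (f x) (f y)"
    proof (rule subset_antisym)
      show "meet (inclusion_order B) (f x) (f y) \<subseteq> f (?M x y)"
        using fM[OF xy] fxy B.meet_closed[of "f x" "f y"] B.meet_left[of "f x" "f y"]
          B.meet_right[of "f x" "f y"] by simp
      show "f (?M x y) \<subseteq> meet (inclusion_order B) (f x) (f y)"
        using fM[OF xy] fxy B.meet_le[of "f (?M x y)" "f x" "f y"] by simp
    qed
  qed
  with A B bij show ?thesis unfolding lattice_isomorphic_def by auto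
qed

section \<open>Subspaces and quotients\<close>

lemma set_addI: "\<lbrakk>u \<in> U; w \<in> W\<rbrakk> \<Longrightarrow> u \<oplus>\<^bsub>G\<^esub> w \<in> U <+>\<^bsub>G\<^esub> W"
  unfolding set_add_def' by blast

context vectorspace
begin

lemma subspaceI:
  assumes "U \<subseteq> carrier V" "\<zero>\<^bsub>V\<^esub> \<in> U" "\<And>u w. \<lbrakk>u \<in> U; w \<in> U\<rbrakk> \<Longrightarrow> u \<oplus>\<^bsub>V\<^esub> w \<in> U"
    and "\<And>c u. \<lbrakk>c \<in> carrier K; u \<in> U\<rbrakk> \<Longrightarrow> c \<odot>\<^bsub>V\<^esub> u \<in> U"
  shows "subspace K U V"
  using assms by (intro subspace.intro submodule.intro vectorspace_axioms module_axioms)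

lemma subspaceD:
  assumes "subspace K U V"
  shows "U \<subseteq> carrier V" "\<zero>\<^bsub>V\<^esub> \<in> U" "\<And>u w. \<lbrakk>u \<in> U; w \<in> U\<rbrakk> \<Longrightarrow> u \<oplus>\<^bsub>V\<^esub> w \<in> U"
    "\<And>c u. \<lbrakk>c \<in> carrier K; u \<in> U\<rbrakk> \<Longrightarrow> c \<odot>\<^bsub>V\<^esub> u \<in> U"
    "\<And>u. u \<in> U \<Longrightarrow> \<ominus>\<^bsub>V\<^esub> u \<in> U"
proof -
  interpret submodule K U V using assms by (rule subspace.submod)
  show "U \<subseteq> carrier V" "\<zero>\<^bsub>V\<^esub> \<in> U" "\<And>u w. \<lbrakk>u \<in> U; w \<in> U\<rbrakk> \<Longrightarrow> u \<oplus>\<^bsub>V\<^esub> w \<in> U"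
    and sm: "\<And>c u. \<lbrakk>c \<in> carrier K; u \<in> U\<rbrakk> \<Longrightarrow> c \<odot>\<^bsub>V\<^esub> u \<in> U"
    using subset by auto
  show "\<ominus>\<^bsub>V\<^esub> u \<in> U" if "u \<in> U" for u
  proof -
    have "\<ominus>\<^bsub>K\<^esub> \<one>\<^bsub>K\<^esub> \<odot>\<^bsub>V\<^esub> u \<in> U" using sm[OF R.a_inv_closed[OF R.one_closed] that] .
    then show ?thesis using smult_minus_1[OF subsetD[OF subset that]] by simp
  qed
qed

lemma minus_add_cancel:
  assumes "x \<in> carrier V" "y \<in> carrier V"
  shows "(x \<ominus>\<^bsub>V\<^esub> y) \<oplus>\<^bsub>V\<^esub> y = x" "(x \<oplus>\<^bsub>V\<^esub> y) \<ominus>\<^bsub>V\<^esub> y = x" "x \<ominus>\<^bsub>V\<^esub> x = \<zero>\<^bsub>V\<^esub>"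
  using assms by (simp_all add: a_minus_def M.a_assoc M.l_neg M.r_neg)

lemma subspace_carrier: "subspace K (carrier V) V"
  by (rule subspaceI) auto

text \<open>The family must be nonempty because the empty intersection is the whole type rather than
  \<open>carrier V\<close>.\<close>

lemma subspace_Inter:
  assumes "\<G> \<noteq> {}" "\<And>U. U \<in> \<G> \<Longrightarrow> subspace K U V"
  shows "subspace K (\<Inter>\<G>) V"
proof (rule subspaceI)
  note D = subspaceD[OF assms(2)]
  show "\<Inter>\<G> \<subseteq> carrier V" using assms(1) D(1) by fast
  show "\<zero>\<^bsub>V\<^esub> \<in> \<Inter>\<G>" using D(2) by (rule InterI)
  show "u \<oplus>\<^bsub>V\<^esub> w \<in> \<Inter>\<G>" if "u \<in> \<Inter>\<G>" "w \<in> \<Inter>\<G>" for u w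
    using that by (intro InterI D(3)) (auto dest: InterD)
  show "c \<odot>\<^bsub>V\<^esub> u \<in> \<Inter>\<G>" if "c \<in> carrier K" "u \<in> \<Inter>\<G>" for c u
    using that by (intro InterI D(4)) (auto dest: InterD)
qed

lemma span_singleton:
  assumes "v \<in> carrier V"
  shows "span {v} = {c \<odot>\<^bsub>V\<^esub> v | c. c \<in> carrier K}"
proof -
  have "span {v} = {lincomb a {v} | a. a \<in> {v} \<rightarrow> carrier K}"
    using assms by (intro finite_span) auto
  also have "\<dots> = {a v \<odot>\<^bsub>V\<^esub> v | a. a \<in> {v} \<rightarrow> carrier K}"
    using assms by (force simp: lincomb_def)
  also have "\<dots> = {c \<odot>\<^bsub>V\<^esub> v | c. c \<in> carrier K}"
  proof safe
    fix c assume "c \<in> carrier K"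
    then show "\<exists>a. c \<odot>\<^bsub>V\<^esub> v = a v \<odot>\<^bsub>V\<^esub> v \<and> a \<in> {v} \<rightarrow> carrier K"
      by (intro exI[of _ "\<lambda>_. c"]) auto
  qed auto
  finally show ?thesis .
qed

lemma span_singleton_subset_iff:
  assumes "subspace K U V" "v \<in> carrier V"
  shows "span {v} \<subseteq> U \<longleftrightarrow> v \<in> U"
  using assms span_self[of v] span_is_subset[of "{v}" U] subspace.submod by blast

lemma subspace_set_add:
  assumes "subspace K U V" "subspace K W V"
  shows "subspace K (U <+>\<^bsub>V\<^esub> W) V"
proof -
  have "U <+>\<^bsub>V\<^esub> W = submodule_sum U W"
    unfolding set_add_def' submodule_sum_def by auto
  with sum_is_subspace[OF assms] show ?thesis by simp
qed

lemma set_add_upper: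
  assumes "subspace K U V" "subspace K W V"
  shows "U \<subseteq> U <+>\<^bsub>V\<^esub> W" "W \<subseteq> U <+>\<^bsub>V\<^esub> W"
proof -
  note U = subspaceD[OF assms(1)] and W = subspaceD[OF assms(2)]
  show "U \<subseteq> U <+>\<^bsub>V\<^esub> W"
  proof
    fix u assume "u \<in> U"
    then have "u = u \<oplus>\<^bsub>V\<^esub> \<zero>\<^bsub>V\<^esub>" using U by auto
    with set_addI[OF \<open>u \<in> U\<close> W(2), of V] show "u \<in> U <+>\<^bsub>V\<^esub> W" by simp
  qed
  show "W \<subseteq> U <+>\<^bsub>V\<^esub> W"
  proof
    fix w assume "w \<in> W"
    then have "w = \<zero>\<^bsub>V\<^esub> \<oplus>\<^bsub>V\<^esub> w" using W by auto
    with set_addI[OF U(2) \<open>w \<in> W\<close>, of V] show "w \<in> U <+>\<^bsub>V\<^esub> W" by simp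
  qed
qed

lemma set_add_least:
  assumes "subspace K X V" "U \<subseteq> X" "W \<subseteq> X"
  shows "U <+>\<^bsub>V\<^esub> W \<subseteq> X"
  using subspaceD(3)[OF assms(1)] assms(2,3) unfolding set_add_def' by blast

lemma span_least:
  assumes "subspace K U V" "S \<subseteq> U"
  shows "span S \<subseteq> U"
  using assms span_is_subset subspace.submod by blast

end

section \<open>Subspaces under linear maps\<close>

lemma (in linear_map) subspace_vimage:
  assumes "subspace K U W"
  shows "subspace K {v \<in> carrier V. T v \<in> U} V"
  using W.subspaceD[OF assms] by (intro V.subspaceI) auto

lemma (in linear_map) subspace_image:
  assumes "subspace K U V"
  shows "subspace K (T ` U) W"
proof (rule W.subspaceI)
  note U = V.subspaceD[OF assms]
  show "T ` U \<subseteq> carrier W" using U(1) by auto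
  show "\<zero>\<^bsub>W\<^esub> \<in> T ` U" using U(2) T0_is_0 by (metis imageI)
  fix x y assume "x \<in> T ` U" "y \<in> T ` U"
  then obtain u v where uv: "u \<in> U" "v \<in> U" "x = T u" "y = T v" by auto
  then have "x \<oplus>\<^bsub>W\<^esub> y = T (u \<oplus>\<^bsub>V\<^esub> v)" using T_add[of u v] U(1) by (simp add: subset_iff)
  then show "x \<oplus>\<^bsub>W\<^esub> y \<in> T ` U" using U(3) uv by auto
next
  note U = V.subspaceD[OF assms]
  fix c x assume c: "c \<in> carrier K" and "x \<in> T ` U"
  then obtain u where u: "u \<in> U" "x = T u" by auto
  then have "c \<odot>\<^bsub>W\<^esub> x = T (c \<odot>\<^bsub>V\<^esub> u)" using U(1) c T_smult by auto
  then show "c \<odot>\<^bsub>W\<^esub> x \<in> T ` U" using U(4) u c by auto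
qed

text \<open>If \<open>T v = T u\<close> with \<open>u\<close> in \<open>U\<close>, then
  \<open>v\<close> differs from \<open>u\<close> by a kernel element, which already lies in
  \<open>U\<close>.\<close>

lemma (in linear_map) vimage_image:
  assumes U: "subspace K U V" and ker: "{v \<in> carrier V. T v = \<zero>\<^bsub>W\<^esub>} \<subseteq> U"
  shows "{v \<in> carrier V. T v \<in> T ` U} = U"
proof safe
  note UD = V.subspaceD[OF U]
  fix v u assume v: "v \<in> carrier V" and u: "u \<in> U" and eq: "T v = T u"
  have uc: "u \<in> carrier V" using UD(1) u by auto
  have "T (v \<ominus>\<^bsub>V\<^esub> u) = T u \<ominus>\<^bsub>W\<^esub> T u" using v uc eq by simp
  also have "\<dots> = \<zero>\<^bsub>W\<^esub>" using T_im[OF uc] T_im[OF uc] by (rule W.minus_add_cancel(3))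
  finally have "v \<ominus>\<^bsub>V\<^esub> u \<in> U" using ker v uc by auto
  then have "(v \<ominus>\<^bsub>V\<^esub> u) \<oplus>\<^bsub>V\<^esub> u \<in> U" using UD(3) u by blast
  also have "(v \<ominus>\<^bsub>V\<^esub> u) \<oplus>\<^bsub>V\<^esub> u = v"
    using v uc by (rule V.minus_add_cancel(1))
  finally show "v \<in> U" .
qed (use V.subspaceD(1)[OF U] in auto)

text \<open>For the projection this translates adding a line in the quotient into adding a line in
  the original space, which is what the flat condition tests.\<close>

lemma (in linear_map) vimage_set_add_span:
  assumes U: "subspace K U W" and v: "v \<in> carrier V"
  shows "{x \<in> carrier V. T x \<in> U <+>\<^bsub>W\<^esub> W.module.span {T v}} = {x \<in> carrier V. T x \<in> U} <+>\<^bsub>V\<^esub> V.module.span {v}"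
proof (intro equalityI subsetI)
  fix x assume "x \<in> {x \<in> carrier V. T x \<in> U <+>\<^bsub>W\<^esub> W.module.span {T v}}"
  then have x: "x \<in> carrier V" "T x \<in> U <+>\<^bsub>W\<^esub> W.module.span {T v}" by simp_all
  then obtain u c where u: "u \<in> U" and c: "c \<in> carrier K" and eq: "T x = u \<oplus>\<^bsub>W\<^esub> c \<odot>\<^bsub>W\<^esub> T v"
    using W.span_singleton[OF T_im[OF v]] unfolding set_add_def' by auto
  have uc: "u \<in> carrier W" using u W.subspaceD(1)[OF U] by auto
  have cv: "c \<odot>\<^bsub>V\<^esub> v \<in> carrier V" "c \<odot>\<^bsub>W\<^esub> T v \<in> carrier W" using c v by auto
  \<comment> \<open>Subtracting \<open>c \<odot> v\<close> from \<open>x\<close> moves it into the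
    preimage of \<open>U\<close>; adding it back splits \<open>x\<close> as required.\<close>
  have "T (x \<ominus>\<^bsub>V\<^esub> c \<odot>\<^bsub>V\<^esub> v) = T x \<ominus>\<^bsub>W\<^esub> c \<odot>\<^bsub>W\<^esub> T v"
    using T_minus[OF x(1) cv(1)] T_smult[OF c v] by simp
  also have "\<dots> = u" unfolding eq using uc cv(2) by (rule W.minus_add_cancel(2))
  finally have "x \<ominus>\<^bsub>V\<^esub> c \<odot>\<^bsub>V\<^esub> v \<in> {x \<in> carrier V. T x \<in> U}" using u x(1) cv(1) by simp
  moreover have "c \<odot>\<^bsub>V\<^esub> v \<in> V.module.span {v}" using c V.span_singleton[OF v] by auto
  ultimately have "(x \<ominus>\<^bsub>V\<^esub> c \<odot>\<^bsub>V\<^esub> v) \<oplus>\<^bsub>V\<^esub> c \<odot>\<^bsub>V\<^esub> v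
      \<in> {x \<in> carrier V. T x \<in> U} <+>\<^bsub>V\<^esub> V.module.span {v}"
    by (rule set_addI)
  then show "x \<in> {x \<in> carrier V. T x \<in> U} <+>\<^bsub>V\<^esub> V.module.span {v}"
    unfolding V.minus_add_cancel(1)[OF x(1) cv(1)] .
next
  fix x assume "x \<in> {x \<in> carrier V. T x \<in> U} <+>\<^bsub>V\<^esub> V.module.span {v}"
  then obtain u c where u: "u \<in> carrier V" "T u \<in> U" and c: "c \<in> carrier K"
    and x: "x = u \<oplus>\<^bsub>V\<^esub> c \<odot>\<^bsub>V\<^esub> v"
    using V.span_singleton[OF v] unfolding set_add_def' by auto
  have "c \<odot>\<^bsub>W\<^esub> T v \<in> W.module.span {T v}" using c W.span_singleton[OF T_im[OF v]] by auto
  then have "T u \<oplus>\<^bsub>W\<^esub> c \<odot>\<^bsub>W\<^esub> T v \<in> U <+>\<^bsub>W\<^esub> W.module.span {T v}" by (rule set_addI[OF u(2)])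
  then show "x \<in> {x \<in> carrier V. T x \<in> U <+>\<^bsub>W\<^esub> W.module.span {T v}}" using u c v x by simp
qed

section \<open>The quotient by a subspace and its projection\<close>

context vectorspace
begin

lemma abelian_subgroup_subspace:
  assumes "subspace K F V"
  shows "abelian_subgroup F V"
proof (rule abelian_subgroupI3)
  show "abelian_group V" by (rule M.abelian_group_axioms)
  show "additive_subgroup F V"
    using subspaceD[OF assms]
    by (intro additive_subgroup.intro group.subgroupI M.a_group) (auto simp flip: a_inv_def)
qed

lemma coset_eq_iff:
  assumes F: "subspace K F V" and "v \<in> carrier V" "w \<in> carrier V"
  shows "F +>\<^bsub>V\<^esub> v = F +>\<^bsub>V\<^esub> w \<longleftrightarrow> v \<ominus>\<^bsub>V\<^esub> w \<in> F"
proof -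
  interpret F: abelian_subgroup F V by (rule abelian_subgroup_subspace[OF F])
  show ?thesis
    using assms F.a_rcos_module[of w v] F.a_repr_independence'[of v w] F.a_rcos_self[of v]
    by (auto simp: a_minus_def)
qed

text \<open>Scaling a coset elementwise fails for \<open>c = 0\<close>, where it gives only the zero
  vector instead of \<open>F\<close>; hence the union of cosets. All representatives yield the same
  coset, since \<open>c\<close> times a difference in \<open>F\<close> stays in \<open>F\<close>,
  and the union collapses.\<close>

lemma smult_coset:
  assumes F: "subspace K F V" and c: "c \<in> carrier K" and v: "v \<in> carrier V"
  shows "(\<Union>x\<in>F +>\<^bsub>V\<^esub> v. F +>\<^bsub>V\<^esub> (c \<odot>\<^bsub>V\<^esub> x)) = F +>\<^bsub>V\<^esub> (c \<odot>\<^bsub>V\<^esub> v)"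
proof -
  interpret F: abelian_subgroup F V by (rule abelian_subgroup_subspace[OF F])
  have sub: "F +>\<^bsub>V\<^esub> v \<subseteq> carrier V"
    using subspaceD(1)[OF F] v by (rule M.a_r_coset_subset_G)
  have "F +>\<^bsub>V\<^esub> (c \<odot>\<^bsub>V\<^esub> x) = F +>\<^bsub>V\<^esub> (c \<odot>\<^bsub>V\<^esub> v)" if "x \<in> F +>\<^bsub>V\<^esub> v" for x
  proof -
    have x: "x \<in> carrier V" using that sub by auto
    have "F +>\<^bsub>V\<^esub> x = F +>\<^bsub>V\<^esub> v" using F.a_repr_independence' that v by metis
    then have "x \<ominus>\<^bsub>V\<^esub> v \<in> F" using coset_eq_iff[OF F x v] by simp
    then have "c \<odot>\<^bsub>V\<^esub> (x \<ominus>\<^bsub>V\<^esub> v) \<in> F" using subspaceD(4)[OF F c] by simp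
    also have "c \<odot>\<^bsub>V\<^esub> (x \<ominus>\<^bsub>V\<^esub> v) = c \<odot>\<^bsub>V\<^esub> x \<ominus>\<^bsub>V\<^esub> c \<odot>\<^bsub>V\<^esub> v"
      using c x v by (simp add: a_minus_def smult_r_distr smult_r_minus)
    finally show ?thesis using coset_eq_iff[OF F] c x v by simp
  qed
  moreover have "v \<in> F +>\<^bsub>V\<^esub> v" using v by (rule F.a_rcos_self)
  ultimately show ?thesis by blast
qed

lemma carrier_quotient_space: "carrier (quotient_space V F) = (\<lambda>v. F +>\<^bsub>V\<^esub> v) ` carrier V"
  unfolding quotient_space_def A_RCOSETS_def' by auto

lemma add_quotient_space:
  assumes "subspace K F V" "v \<in> carrier V" "w \<in> carrier V"
  shows "(F +>\<^bsub>V\<^esub> v) \<oplus>\<^bsub>quotient_space V F\<^esub> (F +>\<^bsub>V\<^esub> w) = F +>\<^bsub>V\<^esub> (v \<oplus>\<^bsub>V\<^esub> w)"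
proof -
  interpret F: abelian_subgroup F V by (rule abelian_subgroup_subspace[OF assms(1)])
  show ?thesis using F.a_rcos_sum assms(2,3) by (simp add: quotient_space_def)
qed

lemma smult_quotient_space:
  assumes "subspace K F V" "c \<in> carrier K" "v \<in> carrier V"
  shows "c \<odot>\<^bsub>quotient_space V F\<^esub> (F +>\<^bsub>V\<^esub> v) = F +>\<^bsub>V\<^esub> (c \<odot>\<^bsub>V\<^esub> v)"
  using smult_coset[OF assms] by (simp add: quotient_space_def)

lemma vectorspace_quotient_space:
  assumes F: "subspace K F V"
  shows "vectorspace K (quotient_space V F)"
proof -
  \<comment> \<open>Written as a coset of the zero vector, the zero of the quotient falls under the
    same representative rules as all other elements.\<close>
  have zero: "\<zero>\<^bsub>quotient_space V F\<^esub> = F +>\<^bsub>V\<^esub> \<zero>\<^bsub>V\<^esub>"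
    using subspaceD(1)[OF F] by (simp add: quotient_space_def)
  have "abelian_group (quotient_space V F)"
  proof (rule abelian_groupI)
    fix x assume "x \<in> carrier (quotient_space V F)"
    then obtain v where v: "v \<in> carrier V" "x = F +>\<^bsub>V\<^esub> v" unfolding carrier_quotient_space by auto
    then show "\<exists>y\<in>carrier (quotient_space V F). y \<oplus>\<^bsub>quotient_space V F\<^esub> x = \<zero>\<^bsub>quotient_space V F\<^esub>"
      unfolding carrier_quotient_space zero
      by (intro bexI[of _ "F +>\<^bsub>V\<^esub> (\<ominus>\<^bsub>V\<^esub> v)"]) (auto simp: add_quotient_space[OF F] M.l_neg)
  qed (auto simp: carrier_quotient_space add_quotient_space[OF F] zero M.a_ac)
  then have "module K (quotient_space V F)"
    using R.cring_axioms
    by (intro moduleI)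
      (auto simp: carrier_quotient_space add_quotient_space[OF F] smult_quotient_space[OF F]
        smult_l_distr smult_r_distr smult_assoc1)
  then show ?thesis by (intro vectorspace.intro field_axioms)
qed

lemma linear_map_coset:
  assumes F: "subspace K F V"
  shows "linear_map K V (quotient_space V F) (\<lambda>v. F +>\<^bsub>V\<^esub> v)"
proof -
  interpret Q: vectorspace K "quotient_space V F" by (rule vectorspace_quotient_space[OF F])
  show ?thesis
    by (intro linear_map.intro mod_hom.intro mod_hom_axioms.intro vectorspace_axioms
        Q.vectorspace_axioms module_axioms Q.module_axioms)
      (auto simp: module_hom_def carrier_quotient_space add_quotient_space[OF F]
        smult_quotient_space[OF F])
qed

lemma coset_eq_zero_iff:
  assumes "subspace K F V" "v \<in> carrier V"
  shows "F +>\<^bsub>V\<^esub> v = \<zero>\<^bsub>quotient_space V F\<^esub> \<longleftrightarrow> v \<in> F"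
proof -
  interpret F: abelian_subgroup F V by (rule abelian_subgroup_subspace[OF assms(1)])
  show ?thesis
    using assms F.a_rcos_self F.a_rcos_const by (auto simp: quotient_space_def)
qed

section \<open>Points of projective space\<close>

lemma dim_span_singleton:
  assumes "v \<in> carrier V" "v \<noteq> \<zero>\<^bsub>V\<^esub>"
  shows "vectorspace.dim K (vs (span {v})) = 1"
proof -
  have sub: "subspace K (span {v}) V" using assms by (intro span_is_subspace) auto
  interpret L: vectorspace K "vs (span {v})" using sub by (rule subspace_is_vs)
  have "v \<in> span {v}" using assms(1) by (rule span_self)
  \<comment> \<open>\<open>L.dim1I\<close> needs the span formed inside the line, which agrees with
    the span in the ambient space.\<close>
  then have "L.span {v} = span {v}"
    using span_li_not_depend(1)[of "{v}" "span {v}"] subspace.submod[OF sub] by auto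
  then show ?thesis using assms(2) \<open>v \<in> span {v}\<close> by (intro L.dim1I) auto
qed

text \<open>Independent sets in \<open>U\<close> stay independent in the whole space, so their size
  is bounded by its dimension; a maximal one is therefore finite, and it generates
  \<open>U\<close>.\<close>

lemma fin_dim_subspace:
  assumes U: "subspace K U V" and fin: "fin_dim"
  shows "vectorspace.fin_dim K (vs U)"
proof -
  interpret U: vectorspace K "vs U" using U by (rule subspace_is_vs)
  have "finite A \<and> card A \<le> dim" if "A \<subseteq> carrier (vs U) \<and> U.lin_indpt A" for A
  proof -
    have "A \<subseteq> U" "lin_indpt A"
      using that span_li_not_depend(2)[of A U] subspace.submod[OF U] by auto
    then show ?thesis using li_le_dim[OF fin, of A] subspaceD(1)[OF U] by auto
  qed
  \<comment> \<open>The empty set shows that there is an independent set to enlarge to a maximal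
    one.\<close>
  moreover have "{} \<subseteq> carrier (vs U) \<and> U.lin_indpt {}" by (simp add: U.lin_dep_def)
  ultimately obtain A where A: "finite A"
    "maximal A (\<lambda>A. A \<subseteq> carrier (vs U) \<and> U.lin_indpt A)"
    using maximal_exists[of "\<lambda>A. A \<subseteq> carrier (vs U) \<and> U.lin_indpt A" dim "{}"] by blast
  then show ?thesis using U.max_li_is_gen unfolding U.fin_dim_def maximal_def by blast
qed

lemma dim_1_imp_span:
  assumes L: "subspace K L V" and dim: "vectorspace.dim K (vs L) = 1" and fin: "fin_dim"
  shows "\<exists>v\<in>L - {\<zero>\<^bsub>V\<^esub>}. L = span {v}"
proof -
  interpret L: vectorspace K "vs L" using L by (rule subspace_is_vs)
  obtain B where B: "finite B" "L.basis B"
    using L.finite_basis_exists fin_dim_subspace[OF L fin] by auto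
  then have "card B = 1" using L.dim_basis[OF B] dim by simp
  then obtain v where "B = {v}" by (rule card_1_singletonE)
  then have v: "L.lin_indpt {v}" "L.span {v} = L" "v \<in> L" using B(2) by (auto simp: L.basis_def)
  then have "v \<noteq> \<zero>\<^bsub>V\<^esub>" using L.vs_zero_lin_dep[of "{v}"] by auto
  moreover have "span {v} = L"
    using v span_li_not_depend(1)[of "{v}" L] subspace.submod[OF L] by auto
  ultimately show ?thesis using v(3) by blast
qed

text \<open>Reconciles the description of points by dimension with the one by generators, so that
  every point of the ground set can be given a nonzero generator.\<close>

lemma projective_space_eq_points:
  assumes "fin_dim"
  shows "projective_space K V = projective_points K V (carrier V)"
proof (intro equalityI subsetI)
  fix L assume "L \<in> projective_space K V"
  then have L: "subspace K L V" "vectorspace.dim K (vs L) = 1"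
    by (auto simp: projective_space_def)
  from dim_1_imp_span[OF this assms] subspaceD(1)[OF L(1)]
  show "L \<in> projective_points K V (carrier V)" unfolding projective_points_def by blast
next
  fix L assume "L \<in> projective_points K V (carrier V)"
  then show "L \<in> projective_space K V"
    using dim_span_singleton span_is_subspace
    by (auto simp: projective_points_def projective_space_def)
qed

text \<open>A point has several generators, but the choice is harmless: a subspace containing one of
  them contains the whole line.\<close>

lemma span_mem_projective_points_iff:
  assumes U: "subspace K U V" and v: "v \<in> carrier V" "v \<noteq> \<zero>\<^bsub>V\<^esub>"
  shows "span {v} \<in> projective_points K V U \<longleftrightarrow> v \<in> U"
proof
  assume "span {v} \<in> projective_points K V U"
  then obtain u where "u \<in> U" "span {v} = span {u}" unfolding projective_points_def by auto
  moreover have "span {u} \<subseteq> U" using \<open>u \<in> U\<close> by (intro span_least[OF U]) auto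
  ultimately show "v \<in> U" using span_self[OF v(1)] by auto
qed (use v in \<open>auto simp: projective_points_def\<close>)

lemma projective_points_mono: "U \<subseteq> W \<Longrightarrow> projective_points K V U \<subseteq> projective_points K V W"
  unfolding projective_points_def by auto

text \<open>The vectors of \<open>G\<close> that leave no trace in the difference are zero and those
  of \<open>F\<close>, and \<open>H\<close> contains them anyway.\<close>

lemma projective_points_diff_subset_iff:
  assumes "subspace K F V" "subspace K G V" "subspace K H V" "F \<subseteq> H"
  shows "projective_points K V G - projective_points K V F
      \<subseteq> projective_points K V H - projective_points K V F \<longleftrightarrow> G \<subseteq> H"
proof
  assume *: "projective_points K V G - projective_points K V F
      \<subseteq> projective_points K V H - projective_points K V F"
  show "G \<subseteq> H"
  proof
    fix v assume v: "v \<in> G"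
    show "v \<in> H"
    proof (cases "v = \<zero>\<^bsub>V\<^esub> \<or> v \<in> F")
      case True
      then show ?thesis using subspaceD(2)[OF assms(3)] assms(4) by auto
    next
      case False
      have "v \<in> carrier V" using v subspaceD(1)[OF assms(2)] by auto
      then show ?thesis
        using * False v span_mem_projective_points_iff assms(1-3) by blast
    qed
  qed
qed (use projective_points_mono in blast)

lemma Union_projective_points_subset:
  assumes "subspace K U V"
  shows "\<Union>(projective_points K V U) \<subseteq> U"
  using span_singleton_subset_iff[OF assms] subspaceD(1)[OF assms]
  unfolding projective_points_def by blast

text \<open>Says that the rank of P(U) in the projectivization is the rank of \<open>U\<close>. The
  span matters for the zero subspace, which has no points and hence an empty union.\<close>

lemma span_Union_projective_points:
  assumes U: "subspace K U V"
  shows "span (\<Union>(projective_points K V U)) = U"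
proof
  let ?P = "\<Union>(projective_points K V U)"
  show "span ?P \<subseteq> U" using U Union_projective_points_subset[OF U] by (rule span_least)
  show "U \<subseteq> span ?P"
  proof
    fix v assume v: "v \<in> U"
    then have vc: "v \<in> carrier V" using subspaceD(1)[OF U] by auto
    show "v \<in> span ?P"
    proof (cases "v = \<zero>\<^bsub>V\<^esub>")
      case False
      then have "v \<in> ?P" using v span_self[OF vc] unfolding projective_points_def by auto
      then show ?thesis
        using Union_projective_points_subset[OF U] subspaceD(1)[OF U] by (intro span_mem) auto
    qed (simp add: span_zero)
  qed
qed

text \<open>The counterpart of \<open>vimage_set_add_span\<close> on the matroid side: adding a
  point to a set enlarges the span by one line.\<close>

lemma span_Union_insert_span:
  assumes S: "\<Union>S \<subseteq> carrier V" and v: "v \<in> carrier V"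
  shows "span (\<Union>(insert (span {v}) S)) = span (\<Union>S) <+>\<^bsub>V\<^esub> span {v}"
proof (rule subset_antisym)
  have sub: "subspace K (span (\<Union>S)) V" "subspace K (span {v}) V"
    using S v by (auto intro!: span_is_subspace)
  have sp: "span {v} \<subseteq> carrier V" using sub(2) subspaceD(1) by blast
  show "span (\<Union>(insert (span {v}) S)) \<subseteq> span (\<Union>S) <+>\<^bsub>V\<^esub> span {v}"
    using in_own_span[OF S] set_add_upper[OF sub]
    by (intro span_least subspace_set_add sub) auto
  have "subspace K (span (\<Union>(insert (span {v}) S))) V"
    using S sp by (intro span_is_subspace) auto
  moreover have "span {v} \<subseteq> span (\<Union>(insert (span {v}) S))"
    using in_own_span[of "\<Union>(insert (span {v}) S)"] S sp by auto
  moreover have "span (\<Union>S) \<subseteq> span (\<Union>(insert (span {v}) S))"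
    by (intro span_is_monotone) auto
  ultimately show "span (\<Union>S) <+>\<^bsub>V\<^esub> span {v} \<subseteq> span (\<Union>(insert (span {v}) S))"
    by (intro set_add_least)
qed

end

section \<open>Flats of contractions\<close>

text \<open>A bound on \<open>a\<close> alone is enough: if \<open>b\<close> is below
  \<open>c\<close>, truncation makes the right difference zero and both sides are false.\<close>

lemma nat_diff_less_diff_iff: "a - c < b - c \<longleftrightarrow> a < b" if "c \<le> a" for a b c :: nat
  using that by arith

context q_matroid
begin

lemma q_flats_iff:
  "F \<in> q_flats K (E, \<rho>) \<longleftrightarrow> subspace K F E \<and>
    (\<forall>v \<in> carrier E - F. \<rho> F < \<rho> (F <+>\<^bsub>E\<^esub> span {v}))"
  by simp

lemma subspace_q_flat: "F \<in> q_flats K (E, \<rho>) \<Longrightarrow> subspace K F E"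
  by simp

text \<open>Given \<open>v\<close> outside the intersection, choose a member \<open>G\<close> that
  misses \<open>v\<close>. Submodularity for \<open>G\<close> and \<open>?S\<close> bounds the rank
  gain from \<open>G\<close> to \<open>G + ?S\<close> by the gain from \<open>G \<inter> ?S\<close>
  to \<open>?S\<close>. The former is positive as \<open>G\<close> is a flat, and the intersection
  of the family lies in \<open>G \<inter> ?S\<close>.\<close>

lemma q_flats_Inter:
  assumes "\<G> \<subseteq> q_flats K (E, \<rho>)" "\<G> \<noteq> {}"
  shows "\<Inter>\<G> \<in> q_flats K (E, \<rho>)"
  unfolding q_flats_iff
proof (intro conjI ballI)
  let ?D = "\<Inter>\<G>"
  show D: "subspace K ?D E" using assms by (intro subspace_Inter) auto
  fix v assume v: "v \<in> carrier E - ?D"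
  then obtain G where G: "G \<in> \<G>" "v \<notin> G" by auto
  have sG: "subspace K G E" and lt: "\<rho> G < \<rho> (G <+>\<^bsub>E\<^esub> span {v})" using G v assms(1) by auto
  have sv: "subspace K (span {v}) E" using v by (intro span_is_subspace) auto
  let ?S = "?D <+>\<^bsub>E\<^esub> span {v}"
  have S: "subspace K ?S E" using D sv by (rule subspace_set_add)
  note GS = subspace_set_add[OF sG S]
  have "?D \<subseteq> G \<inter> ?S" using G set_add_upper[OF D sv] by auto
  moreover have "subspace K (G \<inter> ?S) E"
    using subspace_Inter[of "{G, ?S}"] sG S by auto
  ultimately have 1: "\<rho> ?D \<le> \<rho> (G \<inter> ?S)" using D by (intro rank_mono)
  have "G <+>\<^bsub>E\<^esub> span {v} \<subseteq> G <+>\<^bsub>E\<^esub> ?S"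
    using set_add_upper[OF sG S] set_add_upper[OF D sv] by (intro set_add_least[OF GS]) auto
  then have 2: "\<rho> (G <+>\<^bsub>E\<^esub> span {v}) \<le> \<rho> (G <+>\<^bsub>E\<^esub> ?S)"
    using subspace_set_add[OF sG sv] GS by (intro rank_mono)
  from 1 2 lt rank_submodular[OF sG S] show "\<rho> ?D < \<rho> ?S" by linarith
qed

lemma lattice_q_flats_above:
  assumes "F \<subseteq> carrier E"
  shows "lattice (inclusion_order {G \<in> q_flats K (E, \<rho>). F \<subseteq> G})"
proof (rule lattice_inclusion_Inter)
  \<comment> \<open>The whole space is a flat vacuously, having no vectors outside it.\<close>
  show "carrier E \<in> {G \<in> q_flats K (E, \<rho>). F \<subseteq> G}" using assms subspace_carrier by (simp add: q_flats_iff)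
  show "\<And>x. x \<in> {G \<in> q_flats K (E, \<rho>). F \<subseteq> G} \<Longrightarrow> x \<subseteq> carrier E"
    using subspaceD(1)[OF subspace_q_flat] by blast
  fix \<G> assume "\<G> \<subseteq> {G \<in> q_flats K (E, \<rho>). F \<subseteq> G}" "\<G> \<noteq> {}"
  then show "\<Inter>\<G> \<in> {G \<in> q_flats K (E, \<rho>). F \<subseteq> G}" using q_flats_Inter[of \<G>] by blast
qed

text \<open>The preimage map is the one inside the contracted rank function, so ranks on the two
  sides differ only by the constant \<open>\<rho> F\<close>.\<close>

lemma q_flats_contraction_iso:
  assumes F: "subspace K F E"
  shows "inclusion_iso (\<lambda>W. {v \<in> carrier E. F +>\<^bsub>E\<^esub> v \<in> W})
    (q_flats K (q_contraction (E, \<rho>) F)) {G \<in> q_flats K (E, \<rho>). F \<subseteq> G}"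
proof -
  let ?Q = "quotient_space E F" and ?p = "\<lambda>W. {v \<in> carrier E. F +>\<^bsub>E\<^esub> v \<in> W}"
  interpret p: linear_map K E ?Q "\<lambda>v. F +>\<^bsub>E\<^esub> v" by (rule linear_map_coset[OF F])
  have above: "F \<subseteq> ?p W" if W: "subspace K W ?Q" for W
  proof
    fix v assume v: "v \<in> F"
    have vc: "v \<in> carrier E" using v subspaceD(1)[OF F] by blast
    have "F +>\<^bsub>E\<^esub> v = \<zero>\<^bsub>?Q\<^esub>" using coset_eq_zero_iff[OF F vc] v by blast
    also have "\<dots> \<in> W" using W by (rule p.W.subspaceD(2))
    finally show "v \<in> ?p W" using vc by blast
  qed
  \<comment> \<open>Quantifying over representatives instead of cosets matches the flat condition in
    \<open>E\<close>.\<close>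
  have contraction_iff: "W \<in> q_flats K (q_contraction (E, \<rho>) F) \<longleftrightarrow> subspace K W ?Q \<and>
      (\<forall>v\<in>carrier E. F +>\<^bsub>E\<^esub> v \<notin> W \<longrightarrow>
        \<rho> (?p W) - \<rho> F < \<rho> (?p (W <+>\<^bsub>?Q\<^esub> p.W.module.span {F +>\<^bsub>E\<^esub> v})) - \<rho> F)" for W
    unfolding q_contraction.simps q_flats.simps carrier_quotient_space by blast
  have flat_iff: "W \<in> q_flats K (q_contraction (E, \<rho>) F) \<longleftrightarrow> ?p W \<in> q_flats K (E, \<rho>)"
    if W: "subspace K W ?Q" for W
  proof -
    have sub: "subspace K (?p W) E" by (rule p.subspace_vimage[OF W])
    have le: "\<rho> F \<le> \<rho> (?p W)" using F sub above[OF W] by (rule rank_mono)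
    have "W \<in> q_flats K (q_contraction (E, \<rho>) F) \<longleftrightarrow>
        (\<forall>v\<in>carrier E. F +>\<^bsub>E\<^esub> v \<notin> W \<longrightarrow> \<rho> (?p W) - \<rho> F < \<rho> (?p W <+>\<^bsub>E\<^esub> span {v}) - \<rho> F)"
      using W p.vimage_set_add_span[OF W] unfolding contraction_iff by simp
    also have "\<dots> \<longleftrightarrow> (\<forall>v\<in>carrier E. F +>\<^bsub>E\<^esub> v \<notin> W \<longrightarrow> \<rho> (?p W) < \<rho> (?p W <+>\<^bsub>E\<^esub> span {v}))"
      by (simp add: nat_diff_less_diff_iff[OF le])
    also have "\<dots> \<longleftrightarrow> ?p W \<in> q_flats K (E, \<rho>)" using sub unfolding q_flats_iff by blast
    finally show ?thesis .
  qed
  show ?thesis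
  proof (rule inclusion_isoI)
    show "?p ` q_flats K (q_contraction (E, \<rho>) F) = {G \<in> q_flats K (E, \<rho>). F \<subseteq> G}"
    proof (intro equalityI subsetI)
      fix G assume "G \<in> ?p ` q_flats K (q_contraction (E, \<rho>) F)"
      then obtain W where W: "W \<in> q_flats K (q_contraction (E, \<rho>) F)" "G = ?p W" by auto
      then have "subspace K W ?Q" unfolding contraction_iff by blast
      then show "G \<in> {G \<in> q_flats K (E, \<rho>). F \<subseteq> G}" using flat_iff above W by blast
    next
      fix G assume G: "G \<in> {G \<in> q_flats K (E, \<rho>). F \<subseteq> G}"
      \<comment> \<open>The image of \<open>G\<close> is recovered exactly by its preimage because
        \<open>G\<close> contains the kernel \<open>F\<close>.\<close>
      let ?W = "(\<lambda>v. F +>\<^bsub>E\<^esub> v) ` G"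
      have sG: "subspace K G E" using G subspace_q_flat by blast
      have eq: "?p ?W = G"
      proof (rule p.vimage_image[OF sG])
        show "{v \<in> carrier E. F +>\<^bsub>E\<^esub> v = \<zero>\<^bsub>?Q\<^esub>} \<subseteq> G"
          using G coset_eq_zero_iff[OF F] by blast
      qed
      have "?W \<in> q_flats K (q_contraction (E, \<rho>) F)"
        using flat_iff[OF p.subspace_image[OF sG]] G unfolding eq by blast
      then show "G \<in> ?p ` q_flats K (q_contraction (E, \<rho>) F)" using eq by blast
    qed
  next
    fix W W' assume W: "W \<in> q_flats K (q_contraction (E, \<rho>) F)" "W' \<in> q_flats K (q_contraction (E, \<rho>) F)"
    \<comment> \<open>Each coset in \<open>W\<close> has a representative, so preimages also reflect
      inclusion.\<close>
    have "W \<subseteq> carrier ?Q" using W(1) p.W.subspaceD(1) unfolding contraction_iff by blast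
    then show "?p W \<subseteq> ?p W' \<longleftrightarrow> W \<subseteq> W'" unfolding carrier_quotient_space by blast
  qed
qed

text \<open>Stated for the direction from subspaces to point sets, where inclusions can be compared
  one generator at a time.\<close>

lemma matroid_flats_contraction_iso:
  assumes F: "subspace K F E"
  shows "inclusion_iso (\<lambda>G. projective_points K E G - projective_points K E F)
    {G \<in> q_flats K (E, \<rho>). F \<subseteq> G}
    (matroid_flats (matroid_contraction (projectivization K (E, \<rho>)) (projective_points K E F)))"
proof (rule inclusion_isoI)
  let ?P = "projective_points K E"
  let ?B = "matroid_flats (matroid_contraction (projectivization K (E, \<rho>)) (?P F))"
  have space: "projective_space K E = ?P (carrier E)"
    using finite_dimensional by (rule projective_space_eq_points)
  \<comment> \<open>P(F) spans \<open>F\<close>, so the subtracted rank is \<open>\<rho> F\<close>,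
    and inserting \<open>x\<close> commutes with adjoining P(F).\<close>
  have B_iff: "A \<in> ?B \<longleftrightarrow> A \<subseteq> ?P (carrier E) - ?P F \<and>
      (\<forall>x \<in> ?P (carrier E) - ?P F - A. \<rho> (span (\<Union>(A \<union> ?P F))) - \<rho> F
        < \<rho> (span (\<Union>(insert x (A \<union> ?P F)))) - \<rho> F)" for A
    by (simp add: space span_Union_projective_points[OF F] Un_assoc)
  have le: "\<Union>(?P (carrier E)) \<subseteq> carrier E"
    by (rule Union_projective_points_subset[OF subspace_carrier])
  have Fc: "?P F \<subseteq> ?P (carrier E)" using subspaceD(1)[OF F] by (rule projective_points_mono)
  show "(\<lambda>G. ?P G - ?P F) ` {G \<in> q_flats K (E, \<rho>). F \<subseteq> G} = ?B"
  proof (intro equalityI subsetI)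
    fix A assume "A \<in> (\<lambda>G. ?P G - ?P F) ` {G \<in> q_flats K (E, \<rho>). F \<subseteq> G}"
    then obtain G where G: "G \<in> q_flats K (E, \<rho>)" "F \<subseteq> G" and A: "A = ?P G - ?P F" by auto
    have sG: "subspace K G E" using G(1) by simp
    have Gc: "?P G \<subseteq> ?P (carrier E)" using subspaceD(1)[OF sG] by (rule projective_points_mono)
    have AF: "A \<union> ?P F = ?P G" using projective_points_mono[OF G(2)] A by auto
    show "A \<in> ?B" unfolding B_iff AF
    proof (intro conjI ballI)
      show "A \<subseteq> ?P (carrier E) - ?P F" using A Gc by auto
      fix x assume x: "x \<in> ?P (carrier E) - ?P F - A"
      then obtain v where v: "v \<in> carrier E" "v \<noteq> \<zero>\<^bsub>E\<^esub>" "x = span {v}"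
        unfolding projective_points_def by auto
      have "x \<notin> ?P G" using x A by auto
      then have "v \<notin> G" using span_mem_projective_points_iff[OF sG v(1,2)] v(3) by simp
      then have "\<rho> G < \<rho> (G <+>\<^bsub>E\<^esub> span {v})" using G(1) v(1) by auto
      moreover have "\<rho> F \<le> \<rho> G" using F sG G(2) by (rule rank_mono)
      moreover have "span (\<Union>(insert x (?P G))) = G <+>\<^bsub>E\<^esub> span {v}"
        using span_Union_insert_span[of "?P G" v] Gc le v span_Union_projective_points[OF sG] by auto
      ultimately show "\<rho> (span (\<Union>(?P G))) - \<rho> F < \<rho> (span (\<Union>(insert x (?P G)))) - \<rho> F"
        by (simp add: span_Union_projective_points[OF sG] nat_diff_less_diff_iff)
    qed
  next
    fix A assume "A \<in> ?B"
    then have A: "A \<subseteq> ?P (carrier E) - ?P F"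
      and lt: "\<And>x. x \<in> ?P (carrier E) - ?P F - A \<Longrightarrow>
        \<rho> (span (\<Union>(A \<union> ?P F))) - \<rho> F < \<rho> (span (\<Union>(insert x (A \<union> ?P F)))) - \<rho> F"
      unfolding B_iff by auto
    let ?T = "A \<union> ?P F" and ?G = "span (\<Union>(A \<union> ?P F))"
    have T: "\<Union>?T \<subseteq> carrier E" using A Fc le by blast
    have sG: "subspace K ?G E" using T by (rule span_is_subspace)
    have "span (\<Union>(?P F)) \<subseteq> ?G" by (intro span_is_monotone) auto
    then have FG: "F \<subseteq> ?G" using span_Union_projective_points[OF F] by simp
    have TG: "\<Union>?T \<subseteq> ?G" using T by (rule in_own_span)
    \<comment> \<open>Flatness of \<open>A\<close> in the contraction, read as a strict rank
      increase in \<open>E\<close>.\<close>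
    have step: "\<rho> ?G < \<rho> (?G <+>\<^bsub>E\<^esub> span {v})"
      if v: "v \<in> carrier E" "v \<noteq> \<zero>\<^bsub>E\<^esub>" "span {v} \<notin> ?T" for v
    proof -
      have "span {v} \<in> ?P (carrier E) - ?P F - A"
        using v unfolding projective_points_def by auto
      from lt[OF this] show ?thesis unfolding span_Union_insert_span[OF T v(1)] by simp
    qed
    have "?G \<in> q_flats K (E, \<rho>)" unfolding q_flats_iff
    proof (intro conjI ballI sG)
      fix v assume v: "v \<in> carrier E - ?G"
      then have "v \<noteq> \<zero>\<^bsub>E\<^esub>" using subspaceD(2)[OF sG] by auto
      \<comment> \<open>The line through \<open>v\<close> contains \<open>v\<close>, whereas all
        points of \<open>?T\<close> lie in \<open>?G\<close>.\<close>
      moreover have "span {v} \<notin> ?T" using TG v span_self[of v] by blast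
      ultimately show "\<rho> ?G < \<rho> (?G <+>\<^bsub>E\<^esub> span {v})" using v step by auto
    qed
    moreover have "A = ?P ?G - ?P F"
    proof (intro equalityI subsetI)
      fix x assume x: "x \<in> A"
      then obtain v where v: "v \<in> carrier E" "v \<noteq> \<zero>\<^bsub>E\<^esub>" "x = span {v}"
        using A unfolding projective_points_def by auto
      have "v \<in> ?G" using TG x v span_self[of v] by blast
      then show "x \<in> ?P ?G - ?P F"
        using span_mem_projective_points_iff[OF sG v(1,2)] v(3) A x by auto
    next
      fix x assume x: "x \<in> ?P ?G - ?P F"
      then obtain v where v: "v \<in> ?G" "v \<noteq> \<zero>\<^bsub>E\<^esub>" "x = span {v}"
        unfolding projective_points_def by auto
      have vc: "v \<in> carrier E" using v(1) subspaceD(1)[OF sG] by auto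
      have "span {v} \<subseteq> ?G" using v(1) by (intro span_least[OF sG]) auto
      then have "?G <+>\<^bsub>E\<^esub> span {v} \<subseteq> ?G" by (intro set_add_least[OF sG]) auto
      moreover have "subspace K (span {v}) E" using vc by (intro span_is_subspace) auto
      \<comment> \<open>A line inside \<open>?G\<close> does not raise the rank, so by
        \<open>step\<close> its point must already belong to \<open>?T\<close>.\<close>
      ultimately have "\<rho> (?G <+>\<^bsub>E\<^esub> span {v}) \<le> \<rho> ?G"
        using sG subspace_set_add by (intro rank_mono) auto
      then have "x \<in> ?T" using step[OF vc v(2)] v(3) by auto
      then show "x \<in> A" using x by auto
    qed
    ultimately show "A \<in> (\<lambda>G. ?P G - ?P F) ` {G \<in> q_flats K (E, \<rho>). F \<subseteq> G}"
      using FG by blast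
  qed
  fix G H assume "G \<in> {G \<in> q_flats K (E, \<rho>). F \<subseteq> G}" "H \<in> {G \<in> q_flats K (E, \<rho>). F \<subseteq> G}"
  then show "?P G - ?P F \<subseteq> ?P H - ?P F \<longleftrightarrow> G \<subseteq> H"
    using F by (intro projective_points_diff_subset_iff) auto
qed

end

theorem theorem3p4:
  fixes K :: "('k, 'm) ring_scheme"
    and E :: "('k, 'v, 'n) module_scheme"
    and \<rho> :: "'v set \<Rightarrow> nat"
    and F :: "'v set"
  assumes "q_matroid K E \<rho>"
    and "F \<in> q_flats K (E, \<rho>)"
  shows "lattice_isomorphic
    (inclusion_order (q_flats K (q_contraction (E, \<rho>) F)))
    (inclusion_order (matroid_flats
      (matroid_contraction (projectivization K (E, \<rho>)) (projective_points K E F))))"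
proof -
  interpret q_matroid K E \<rho> by (rule assms(1))
  have F: "subspace K F E" using assms(2) by simp
  note above = lattice_q_flats_above[OF subspaceD(1)[OF F]]
  note contraction = q_flats_contraction_iso[OF F]
  \<comment> \<open>The lattice property is known for the flats above \<open>F\<close> and is pulled
    back along the inverse isomorphism, so that the composite starts at a lattice.\<close>
  have "lattice (inclusion_order (q_flats K (q_contraction (E, \<rho>) F)))"
    using lattice_isomorphicI[OF inclusion_iso_inv[OF contraction] above]
    by (simp add: lattice_isomorphic_def)
  with inclusion_iso_trans[OF contraction matroid_flats_contraction_iso[OF F]]
  show ?thesis by (rule lattice_isomorphicI)
qed

end
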